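(* Let $E$ be a Hilbert space and let $\tau$ be a Hausdorff topology on $E$. Let $\{ T(t) : t \geq 0 \}$ be a one-parameter $\tau$-continuous semigroup of nonexpansive mappings on a bounded closed convex subset $C$ of $E$. Fix $\alpha, \beta > 0$ with $\alpha / \beta \notin \mathbb{Q}$. Let $x \in C$ and define a sequence $\{ x_n \}$ in $C$ by $$ x_{n} = \frac{1}{n^2} \sum_{k=1}^n \sum_{\ell=1}^n T(k \alpha + \ell \beta) x $$ for $n \in \mathbb{N}$. Then $\{ x_n \}$ converges weakly to a common fixed point of $\{ T(t) : t \geq 0 \}$.
   Context: $\mathbb{N}$ is the set of positive integers and $\mathbb{Q}$ the set of rational numbers. Let $C$ be a subset of a Banach space $E$ and let $\tau$ be a Hausdorff topology on $E$ (not necessarily the norm topology). A family $\{T(t) : t \geq 0\}$ of mappings from $C$ into $C$ is called a one-parameter $\tau$-continuous semigroup of nonexpansive mappings on $C$ if: (sg 1) $T(s+t) = T(s) \circ T(t)$ for all $s, t \geq 0$; (sg 2) for each $x \in C$, the mapping $t \mapsto T(t)x$ from $[0,\infty)$ into $C$ is continuous with respect to $\tau$; (sg 3) for each $t \geq 0$, $T(t)$ is nonexpansive, i.e., $\|T(t)x - T(t)y\| \leq \|x-y\|$ for all $x,y \in C$. (It is not required that $T(0)$ be the identity mapping.) A common fixed point of $\{T(t) : t \geq 0\}$ is a point $z \in C$ with $T(t)z = z$ for all $t \geq 0$. *)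

theory Defs
  imports "HOL-Analysis.Analysis"
begin

text \<open>
  The topology \<open>\<tau>\<close> need not be related to the norm or to the linear structure of the space.
  \<open>T 0\<close> is not required to be the identity on \<open>C\<close>.
\<close>

definition nonexpansive_semigroup ::
    "'a::banach topology \<Rightarrow> 'a set \<Rightarrow> (real \<Rightarrow> 'a \<Rightarrow> 'a) \<Rightarrow> bool" where
  "nonexpansive_semigroup \<tau> C T \<longleftrightarrow>
     (\<forall>t\<ge>0. T t \<in> C \<rightarrow> C) \<and>
     (\<forall>s\<ge>0. \<forall>t\<ge>0. \<forall>x\<in>C. T (s + t) x = T s (T t x)) \<and>
     (\<forall>x\<in>C. continuous_map (top_of_set {0..}) (subtopology \<tau> C) (\<lambda>t. T t x)) \<and>
     (\<forall>t\<ge>0. \<forall>x\<in>C. \<forall>y\<in>C. norm (T t x - T t y) \<le> norm (x - y))"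

definition common_fixed_point ::
    "'a set \<Rightarrow> (real \<Rightarrow> 'a \<Rightarrow> 'a) \<Rightarrow> 'a \<Rightarrow> bool" where
  "common_fixed_point C T z \<longleftrightarrow> z \<in> C \<and> (\<forall>t\<ge>0. T t z = z)"

definition weakly_converges_to ::
    "(nat \<Rightarrow> 'a::real_normed_vector) \<Rightarrow> 'a \<Rightarrow> bool" where
  "weakly_converges_to X z \<longleftrightarrow>
     (\<forall>f :: 'a \<Rightarrow> real. bounded_linear f \<longrightarrow> (\<lambda>n. f (X n)) \<longlonglongrightarrow> f z)"

end

theory Submission
  imports Defs
begin

text \<open>
  Put \<open>u k l = T (k \<alpha> + l \<beta>) x\<close>, an orbit of the commuting nonexpansive maps \<open>T \<alpha>\<close> and \<open>T \<beta>\<close>.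
  Averaging the inequality \<open>\<parallel>T \<alpha> (u k l) - T \<alpha> y\<parallel>\<^sup>2 \<le> \<parallel>u k l - y\<parallel>\<^sup>2\<close> telescopes and shows that every weak
  cluster point \<open>y\<close> of the averages is fixed by \<open>T \<alpha>\<close>, and likewise by \<open>T \<beta>\<close>.
  The times \<open>t\<close> with \<open>T t y = y\<close> form a closed set, as \<open>\<tau>\<close> is Hausdorff, and it is stable under sums and
  nonnegative differences; containing the incommensurable \<open>\<alpha>\<close> and \<open>\<beta>\<close>, it is the whole half-line.
  For common fixed points \<open>f, g\<close> the distances \<open>\<parallel>u k l - f\<parallel>\<close> and \<open>\<parallel>u k l - g\<parallel>\<close> decrease in \<open>k\<close> and \<open>l\<close>, so
  the inner products of the averages with \<open>f - g\<close> converge. Taking two cluster points for \<open>f, g\<close> shows that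
  they coincide, and weak compactness gives convergence.
\<close>

section \<open>Hilbert space preliminaries\<close>

text \<open>By the parallelogram law near-minimisers of the distance to \<open>a\<close> are close
  to each other, so completeness, in place of compactness, yields a nearest point. Its variational
  inequality is the form used for separating points from \<open>S\<close>.\<close>

lemma nearest_point_exists:
  fixes S :: "'a::{real_inner, banach} set"
  assumes "convex S" "closed S" "S \<noteq> {}"
  obtains p where "p \<in> S" "\<And>y. y \<in> S \<Longrightarrow> (a - p) \<bullet> (y - p) \<le> 0"
proof -
  define d where "d = infdist a S"
  have d0: "d \<ge> 0" by (simp add: d_def infdist_nonneg)
  have d_le: "d \<le> dist a y" if "y \<in> S" for y
    using that by (simp add: d_def infdist_le)
  define A where "A = (\<lambda>n::nat. S \<inter> cball a (d + 1 / real (Suc n)))"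
  \<comment> \<open>The midpoint of \<open>p\<close> and \<open>q\<close> lies in the convex set
    \<open>S\<close>, hence at distance at least \<open>d\<close> from \<open>a\<close>. The bound
    is \<open>4 * ((d + e)\<^sup>2 - d\<^sup>2)\<close>.\<close>
  have diam: "(dist p q)\<^sup>2 \<le> 4 * (2 * d * e + e\<^sup>2)"
    if "p \<in> S \<inter> cball a (d + e)" "q \<in> S \<inter> cball a (d + e)" "e \<ge> 0" for p q e
  proof -
    have "(1/2) *\<^sub>R p + (1/2) *\<^sub>R q \<in> S"
      using that assms(1) by (intro convexD) auto
    then have "d\<^sup>2 \<le> (dist a ((1/2) *\<^sub>R p + (1/2) *\<^sub>R q))\<^sup>2"
      using d_le d0 power_mono by blast
    moreover have "(dist a p)\<^sup>2 \<le> (d + e)\<^sup>2" "(dist a q)\<^sup>2 \<le> (d + e)\<^sup>2"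
      using that by (auto intro!: power_mono)
    moreover have "(dist p q)\<^sup>2 = 2 * (dist a p)\<^sup>2 + 2 * (dist a q)\<^sup>2
        - 4 * (dist a ((1/2) *\<^sub>R p + (1/2) *\<^sub>R q))\<^sup>2"
      by (simp add: dist_norm power2_norm_eq_inner inner_simps inner_commute algebra_simps)
    ultimately show ?thesis
      by (simp add: power2_eq_square algebra_simps)
  qed
  have "\<exists>p. \<forall>n. p \<in> A n"
  proof (rule decreasing_closed_nest)
    show "closed (A n)" for n
      using assms by (auto simp: A_def)
    show "A n \<noteq> {}" for n
    proof -
      have "\<exists>y\<in>S. dist a y < d + 1 / real (Suc n)"
        unfolding d_def infdist_notempty[OF assms(3)]
        using assms(3) by (subst cInf_less_iff[symmetric, where X = "dist a ` S", simplified]) auto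
      then show ?thesis by (force simp: A_def)
    qed
    show "A n \<subseteq> A m" if "m \<le> n" for m n
    proof -
      have "1 / real (Suc n) \<le> 1 / real (Suc m)" using that by (simp add: frac_le)
      then show ?thesis by (force simp: A_def)
    qed
    show "\<exists>n. \<forall>x\<in>A n. \<forall>y\<in>A n. dist x y < e" if "e > 0" for e
    proof -
      have "(\<lambda>n. 4 * (2 * d * (1 / real (Suc n)) + (1 / real (Suc n))\<^sup>2)) \<longlonglongrightarrow> 4 * (2 * d * 0 + 0\<^sup>2)"
        using LIMSEQ_inverse_real_of_nat by (intro tendsto_intros) (simp_all add: inverse_eq_divide)
      then have "eventually (\<lambda>n. 4 * (2 * d * (1 / real (Suc n)) + (1 / real (Suc n))\<^sup>2) < e\<^sup>2) sequentially"
        using that by (intro order_tendstoD) auto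
      then obtain n where "4 * (2 * d * (1 / real (Suc n)) + (1 / real (Suc n))\<^sup>2) < e\<^sup>2"
        by (auto dest: eventually_happens)
      then have "(dist x y)\<^sup>2 < e\<^sup>2" if "x \<in> A n" "y \<in> A n" for x y
        using diam[of x "1 / real (Suc n)" y] that by (force simp: A_def)
      then show ?thesis using \<open>e > 0\<close> by (meson less_imp_le power2_less_imp_less)
    qed
  qed auto
  then obtain p where p: "p \<in> S" "\<And>n. dist a p \<le> d + 1 / real (Suc n)"
    by (auto simp: A_def)
  have "(\<lambda>n. d + 1 / real (Suc n)) \<longlonglongrightarrow> d + 0"
    using LIMSEQ_inverse_real_of_nat by (intro tendsto_intros) (simp_all add: inverse_eq_divide)
  then have "dist a p \<le> d"
    using p(2) by (auto intro: LIMSEQ_le_const)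
  then have "\<forall>z\<in>S. dist a p \<le> dist a z" using d_le by fastforce
  with p(1) show ?thesis
    using any_closest_point_dot[OF assms(1,2) p(1)] that by blast
qed

text \<open>For nonzero \<open>f\<close>, the point \<open>p\<close> of the hyperplane
  \<open>f = 1\<close> nearest to the origin is orthogonal to the kernel of \<open>f\<close>;
  scaling it by \<open>1 / (p \<bullet> p)\<close> represents \<open>f\<close>.\<close>

lemma riesz_representation:
  fixes f :: "'a::{real_inner, banach} \<Rightarrow> real"
  assumes "bounded_linear f"
  obtains y where "\<And>w. f w = w \<bullet> y"
proof (cases "\<forall>w. f w = 0")
  case True
  then show ?thesis using that[of 0] by simp
next
  case False
  interpret f: bounded_linear f by fact
  from False obtain w0 where "f w0 \<noteq> 0" by blast
  then have "f ((1 / f w0) *\<^sub>R w0) = 1" by (simp add: f.scaleR)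
  moreover have "closed (f -` {1})"
    by (intro closed_vimage) (auto intro!: f.continuous_on continuous_on_id)
  moreover have "convex (f -` {1})"
    by (auto simp: convex_def f.add f.scaleR)
  ultimately obtain p where "p \<in> f -` {1}" and "\<And>y. y \<in> f -` {1} \<Longrightarrow> (0 - p) \<bullet> (y - p) \<le> 0"
    using nearest_point_exists[of "f -` {1}" 0] by (metis vimage_singleton_eq empty_iff)
  then have p: "f p = 1" and dot: "\<And>y. f y = 1 \<Longrightarrow> (0 - p) \<bullet> (y - p) \<le> 0"
    by auto
  \<comment> \<open>Both \<open>p + h\<close> and \<open>p - h\<close> lie in the hyperplane, so the
    variational inequality holds with either sign.\<close>
  have orth: "p \<bullet> h = 0" if "f h = 0" for h
    using dot[of "p + h"] dot[of "p - h"] that p by (simp add: f.add f.diff)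
  have "p \<noteq> 0" using p f.zero by force
  have "f w = w \<bullet> ((1 / (p \<bullet> p)) *\<^sub>R p)" for w
  proof -
    have "p \<bullet> (w - f w *\<^sub>R p) = 0"
      by (rule orth) (simp add: f.diff f.scaleR p)
    then show ?thesis using \<open>p \<noteq> 0\<close>
      by (simp add: inner_diff_right inner_commute field_simps)
  qed
  then show ?thesis using that by blast
qed

text \<open>If \<open>p\<close> is the projection of \<open>y\<close> onto \<open>S\<close>, the
  functional given by \<open>y - p\<close> bounds \<open>S\<close> from one side; this bound
  survives the weak limit and forces \<open>y = p\<close>. A general filter \<open>G\<close> plays
  the role of a subnet.\<close>

lemma weak_limit_in_closed_convex:
  fixes S :: "'a::{real_inner, banach} set"
  assumes "convex S" "closed S" "G \<noteq> bot"
    and ev: "eventually (\<lambda>i. X i \<in> S) G"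
    and lim: "\<And>w. ((\<lambda>i. w \<bullet> X i) \<longlongrightarrow> w \<bullet> y) G"
  shows "y \<in> S"
proof -
  have "S \<noteq> {}" using ev assms(3) eventually_happens by force
  then obtain p where p: "p \<in> S" "\<And>z. z \<in> S \<Longrightarrow> (y - p) \<bullet> (z - p) \<le> 0"
    using nearest_point_exists assms by metis
  have "((\<lambda>i. (y - p) \<bullet> X i - (y - p) \<bullet> p) \<longlongrightarrow> (y - p) \<bullet> y - (y - p) \<bullet> p) G"
    by (intro tendsto_intros lim)
  moreover have "eventually (\<lambda>i. (y - p) \<bullet> X i - (y - p) \<bullet> p \<le> 0) G"
    using ev by eventually_elim (use p(2) in \<open>simp add: inner_diff_right\<close>)
  ultimately have "(y - p) \<bullet> y - (y - p) \<bullet> p \<le> 0"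
    using assms(3) by (rule tendsto_upperbound)
  then have "(y - p) \<bullet> (y - p) \<le> 0" by (simp add: inner_diff_right)
  then have "y = p" by (metis inner_gt_zero_iff leD right_minus_eq)
  then show ?thesis using p by simp
qed

text \<open>The functionals \<open>w \<mapsto> w \<bullet> X i\<close> lie in a product of compact intervals, so Tychonoff's
  theorem yields weak compactness without any separability assumption.\<close>

lemma bounded_weak_cluster_point:
  fixes X :: "'b \<Rightarrow> 'a::{real_inner, banach}"
  assumes "F \<noteq> bot" and bdd: "eventually (\<lambda>i. norm (X i) \<le> B) F"
  obtains G y where "G \<le> F" "G \<noteq> bot" "\<And>w. ((\<lambda>i. w \<bullet> X i) \<longlongrightarrow> w \<bullet> y) G"
proof -
  define K where "K = (\<Pi>\<^sub>E w\<in>(UNIV::'a set). {- (norm w * B)..norm w * B})"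
  define \<phi> where "\<phi> = (\<lambda>i w. w \<bullet> X i)"
  have "compactin (product_topology (\<lambda>_. euclideanreal) (UNIV::'a set)) K"
    unfolding K_def by (subst compactin_PiE) auto
  then have "compact K" by (simp add: euclidean_product_topology)
  have "eventually (\<lambda>i. \<phi> i \<in> K) F"
    using bdd
  proof eventually_elim
    case (elim i)
    have "\<bar>w \<bullet> X i\<bar> \<le> norm w * B" for w
      using Cauchy_Schwarz_ineq2[of w "X i"] mult_left_mono[OF elim norm_ge_zero[of w]] by linarith
    then have "- (norm w * B) \<le> w \<bullet> X i \<and> w \<bullet> X i \<le> norm w * B" for w
      by (metis abs_le_iff minus_le_iff)
    then show ?case by (auto simp: K_def \<phi>_def)
  qed
  then have "eventually (\<lambda>g. g \<in> K) (filtermap \<phi> F)"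
    by (simp add: eventually_filtermap)
  moreover have "filtermap \<phi> F \<noteq> bot" using assms(1) by (simp add: filtermap_bot_iff)
  ultimately obtain f where f: "inf (nhds f) (filtermap \<phi> F) \<noteq> bot"
    using \<open>compact K\<close> unfolding compact_filter by blast
  \<comment> \<open>\<open>f\<close> is a cluster point of the image filter. Refining
    \<open>F\<close> by the preimages of the neighbourhoods of \<open>f\<close> turns clustering
    into convergence of \<open>\<phi>\<close> to \<open>f\<close>, as a subnet would.\<close>
  define G where "G = inf (filtercomap \<phi> (nhds f)) F"
  have "G \<noteq> bot"
  proof
    assume "G = bot"
    then obtain P Q where PQ: "eventually P (filtercomap \<phi> (nhds f))" "eventually Q F"
      "\<And>i. P i \<Longrightarrow> Q i \<Longrightarrow> False"
      unfolding G_def trivial_limit_def eventually_inf by blast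
    then obtain R where R: "eventually R (nhds f)" "\<And>i. R (\<phi> i) \<Longrightarrow> P i"
      by (auto simp: eventually_filtercomap)
    have "eventually (\<lambda>g. \<not> R g) (filtermap \<phi> F)"
      unfolding eventually_filtermap using PQ(2) by eventually_elim (use PQ(3) R(2) in blast)
    then have "eventually (\<lambda>_. False) (inf (nhds f) (filtermap \<phi> F))"
      using R(1) unfolding eventually_inf by blast
    then show False using f by (simp add: trivial_limit_def)
  qed
  have "(\<phi> \<longlongrightarrow> f) G"
    unfolding filterlim_iff_le_filtercomap G_def by simp
  have lim: "((\<lambda>i. w \<bullet> X i) \<longlongrightarrow> f w) G" for w
  proof -
    have "continuous_on UNIV (\<lambda>g::'a \<Rightarrow> real. g w)"
      by (rule continuous_on_product_coordinates)
    then have "((\<lambda>g. g w) \<longlongrightarrow> f w) (at f)"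
      by (simp add: continuous_on_def)
    then have "((\<lambda>i. \<phi> i w) \<longlongrightarrow> f w) G"
      by (rule tendsto_compose[OF _ \<open>(\<phi> \<longlongrightarrow> f) G\<close>])
    then show ?thesis by (simp add: \<phi>_def)
  qed
  have bddG: "eventually (\<lambda>i. norm (X i) \<le> B) G"
    using bdd by (simp add: G_def filter_leD[OF inf_le2])
  \<comment> \<open>Linearity and the bound pass to pointwise limits along \<open>G\<close>, so
    \<open>f\<close> is represented by a vector, the weak limit.\<close>
  have "bounded_linear f"
  proof (rule bounded_linear_intro)
    show "f (v + w) = f v + f w" for v w
      using tendsto_unique[OF \<open>G \<noteq> bot\<close> lim] tendsto_add[OF lim[of v] lim[of w]]
      by (simp add: inner_add_left)
    show "f (r *\<^sub>R w) = r *\<^sub>R f w" for r w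
      using tendsto_unique[OF \<open>G \<noteq> bot\<close> lim] tendsto_mult_left[OF lim[of w], of r]
      by simp
    show "norm (f w) \<le> norm w * B" for w
    proof (rule tendsto_upperbound[OF tendsto_norm[OF lim] _ \<open>G \<noteq> bot\<close>])
      show "eventually (\<lambda>i. norm (w \<bullet> X i) \<le> norm w * B) G"
        using bddG
        by eventually_elim (metis Cauchy_Schwarz_ineq2 mult_left_mono norm_ge_zero order_trans real_norm_def)
    qed
  qed
  then obtain y where "\<And>w. f w = w \<bullet> y" using riesz_representation by blast
  with lim \<open>G \<noteq> bot\<close> show ?thesis
    using that[of G y] by (simp add: G_def)
qed

section \<open>Averages over squares\<close>

text \<open>The limit is the infimum \<open>L\<close> of the diagonal. Once \<open>a N N\<close> is
  close to \<open>L\<close>, so is every entry with \<open>k \<ge> N\<close> and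
  \<open>l \<ge> N\<close>. The remaining entries are at most \<open>a 0 0\<close> and lie in two
  strips with at most \<open>N * n\<close> indices each, negligible against
  \<open>n * n\<close>.\<close>

lemma convergent_square_average:
  fixes a :: "nat \<Rightarrow> nat \<Rightarrow> real"
  assumes dec1: "\<And>k l. a (Suc k) l \<le> a k l" and dec2: "\<And>k l. a k (Suc l) \<le> a k l"
    and nonneg: "\<And>k l. 0 \<le> a k l"
  shows "convergent (\<lambda>n. (\<Sum>k=1..n. \<Sum>l=1..n. a k l) / (real n)\<^sup>2)"
proof -
  have mono: "a k' l' \<le> a k l" if "k \<le> k'" "l \<le> l'" for k k' l l'
    using lift_Suc_antimono_le[of "\<lambda>k. a k l'", OF dec1 that(1)]
      lift_Suc_antimono_le[of "\<lambda>l. a k l", OF dec2 that(2)] by simp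
  define L where "L = (INF m. a m m)"
  have bdd: "bdd_below (range (\<lambda>m. a m m))" using nonneg by (intro bdd_belowI[of _ 0]) auto
  have L_le: "L \<le> a k l" for k l
  proof -
    have "L \<le> a (max k l) (max k l)" unfolding L_def by (rule cINF_lower[OF bdd]) simp
    also have "\<dots> \<le> a k l" by (rule mono) auto
    finally show ?thesis .
  qed
  define A where "A = (\<lambda>n. (\<Sum>k=1..n. \<Sum>l=1..n. a k l) / (real n)\<^sup>2)"
  have "A \<longlonglongrightarrow> L"
  proof (rule tendstoI)
    fix e :: real assume "e > 0"
    have "\<exists>m. a m m < L + e/2"
      using \<open>e > 0\<close> cINF_less_iff[OF _ bdd, of "L + e/2"] by (simp add: L_def)
    then obtain N where N: "a N N < L + e/2" by blast
    define M where "M = a 0 0"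
    have "M \<ge> 0" by (simp add: M_def nonneg)
    have "L \<ge> 0" unfolding L_def by (rule cINF_greatest) (auto simp: nonneg)
    have le: "a k l \<le> (L + e/2) + (if k < N then M else 0) + (if l < N then M else 0)" for k l
      using mono[of N k N l] mono[of 0 k 0 l] N \<open>M \<ge> 0\<close> \<open>L \<ge> 0\<close> \<open>e > 0\<close>
      by (auto simp: M_def not_less)
    have cnt: "(\<Sum>k=1..n. if k < N then M else 0) \<le> real N * M" for n
    proof -
      have "(\<Sum>k=1..n. if k < N then M else 0) = real (card {k\<in>{1..n}. k < N}) * M"
        by (simp flip: sum.inter_filter)
      also have "card {k\<in>{1..n}. k < N} \<le> card {..<N}" by (rule card_mono) auto
      finally show ?thesis using \<open>M \<ge> 0\<close> by (simp add: mult_right_mono)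
    qed
    have upper: "A n \<le> L + e/2 + 2 * (real N * M) * (1 / real n)" if "n > 0" for n
    proof -
      have "(\<Sum>k=1..n. \<Sum>l=1..n. a k l)
        \<le> (\<Sum>k=1..n. \<Sum>l=1..n. (L + e/2) + (if k < N then M else 0) + (if l < N then M else 0))"
        by (intro sum_mono le)
      also have "\<dots> = (real n)\<^sup>2 * (L + e/2)
          + real n * (\<Sum>k=1..n. if k < N then M else 0) + real n * (\<Sum>l=1..n. if l < N then M else 0)"
        by (simp add: sum.distrib sum_distrib_left power2_eq_square algebra_simps del: sum.delta)
      also have "\<dots> \<le> (real n)\<^sup>2 * (L + e/2) + real n * (real N * M) + real n * (real N * M)"
        by (intro add_mono mult_left_mono cnt) auto
      finally show ?thesis using that
        by (simp add: A_def field_simps power2_eq_square)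
    qed
    have lower: "L \<le> A n" if "n > 0" for n
    proof -
      have "(\<Sum>k=1..n. \<Sum>l=1..n. L) \<le> (\<Sum>k=1..n. \<Sum>l=1..n. a k l)"
        by (intro sum_mono L_le)
      then show ?thesis using that by (simp add: A_def field_simps power2_eq_square)
    qed
    have "(\<lambda>n. L + e/2 + 2 * (real N * M) * (1 / real n)) \<longlonglongrightarrow> L + e/2 + 2 * (real N * M) * 0"
      by (intro tendsto_intros lim_1_over_n)
    then have "eventually (\<lambda>n. L + e/2 + 2 * (real N * M) * (1 / real n) < L + e) sequentially"
      using \<open>e > 0\<close> by (intro order_tendstoD) auto
    then show "eventually (\<lambda>n. dist (A n) L < e) sequentially"
      using eventually_gt_at_top[of 0]
    proof eventually_elim
      case (elim n)
      then show ?case using upper[of n] lower[of n] by (simp add: dist_real_def)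
    qed
  qed
  then show ?thesis unfolding A_def convergent_def by blast
qed

text \<open>At \<open>n = 0\<close> the value is 0, which need not lie in a set containing the
  orbit; hence the restrictions to \<open>n > 0\<close> below.\<close>

definition square_average :: "(nat \<Rightarrow> nat \<Rightarrow> 'a::real_vector) \<Rightarrow> nat \<Rightarrow> 'a" where
  "square_average u n = (1 / (real n)\<^sup>2) *\<^sub>R (\<Sum>k=1..n. \<Sum>l=1..n. u k l)"

lemma square_average_swap: "square_average (\<lambda>k l. u l k) = square_average u"
  unfolding square_average_def by (subst sum.swap) simp

lemma square_average_in_convex:
  assumes "convex C" "\<And>k l. u k l \<in> C" "n > 0"
  shows "square_average u n \<in> C"
proof -
  \<comment> \<open>The double average is a convex combination of convex combinations.\<close>
  have "square_average u n = (\<Sum>k=1..n. (1 / real n) *\<^sub>R (\<Sum>l=1..n. (1 / real n) *\<^sub>R u k l))"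
    by (simp add: square_average_def power2_eq_square flip: scaleR_sum_right)
  moreover have "(\<Sum>l=1..n. (1 / real n) *\<^sub>R u k l) \<in> C" for k
    using assms by (intro convex_sum) auto
  ultimately show ?thesis using assms by (auto intro!: convex_sum)
qed

text \<open>Averaging \<open>\<parallel>S (u k l) - S y\<parallel>\<^sup>2 \<le> \<parallel>u k l - y\<parallel>\<^sup>2\<close> telescopes in \<open>k\<close>, up to a boundary term of
  order \<open>1 / n\<close>; expanding the right-hand side about \<open>S y\<close> makes it linear in the average.\<close>

lemma square_average_cluster_fixed:
  fixes u :: "nat \<Rightarrow> nat \<Rightarrow> 'a::real_inner"
  assumes "bounded C" and SC: "S \<in> C \<rightarrow> C"
    and nonexp: "\<And>v w. v \<in> C \<Longrightarrow> w \<in> C \<Longrightarrow> norm (S v - S w) \<le> norm (v - w)"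
    and uC: "\<And>k l. u k l \<in> C" and step: "\<And>k l. u (Suc k) l = S (u k l)"
    and G: "G \<le> sequentially" "G \<noteq> bot"
    and lim: "\<And>w. ((\<lambda>n. w \<bullet> square_average u n) \<longlongrightarrow> w \<bullet> y) G"
    and "y \<in> C"
  shows "S y = y"
proof -
  define D where "D = S y - y"
  define a where "a = (\<lambda>k l. (norm (u k l - S y))\<^sup>2)"
  obtain B where B: "\<And>v. v \<in> C \<Longrightarrow> norm v \<le> B"
    using \<open>bounded C\<close> by (auto simp: bounded_iff)
  define M where "M = (2 * B)\<^sup>2"
  have aM: "a k l \<le> M" for k l
  proof -
    have "S y \<in> C" using SC \<open>y \<in> C\<close> by auto
    then have "norm (u k l - S y) \<le> 2 * B"
      using norm_triangle_ineq4[of "u k l" "S y"] B[OF uC[of k l]] B[of "S y"] by linarith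
    then show ?thesis unfolding a_def M_def by (rule power_mono) simp
  qed
  have a0: "0 \<le> a k l" for k l by (simp add: a_def)
  have est: "a (Suc k) l - a k l \<le> D \<bullet> D - 2 * (D \<bullet> S y) + 2 * (D \<bullet> u k l)" for k l
  proof -
    have "a (Suc k) l \<le> (norm (u k l - y))\<^sup>2"
      unfolding a_def step by (intro power_mono nonexp uC \<open>y \<in> C\<close>) simp
    also have "\<dots> = a k l + D \<bullet> D - 2 * (D \<bullet> S y) + 2 * (D \<bullet> u k l)"
      by (simp add: a_def D_def power2_norm_eq_inner inner_simps inner_commute algebra_simps)
    finally show ?thesis by simp
  qed
  have bound: "- (M * (1 / real n)) \<le> D \<bullet> D - 2 * (D \<bullet> S y) + 2 * (D \<bullet> square_average u n)"
    if "n > 0" for n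
  proof -
    have "- (real n * M) = (\<Sum>l=1..n. - M)" by simp
    also have "\<dots> \<le> (\<Sum>l=1..n. a (Suc n) l - a 1 l)"
    proof (rule sum_mono)
      show "- M \<le> a (Suc n) l - a 1 l" for l
        using aM[of 1 l] a0[of "Suc n" l] by simp
    qed
    \<comment> \<open>The boundary terms are written back as telescoping sums so that
      \<open>est\<close> applies to each summand.\<close>
    also have "\<dots> = (\<Sum>l=1..n. \<Sum>k=1..n. a (Suc k) l - a k l)"
      by (subst sum_Suc_diff) auto
    also have "\<dots> = (\<Sum>k=1..n. \<Sum>l=1..n. a (Suc k) l - a k l)"
      by (rule sum.swap)
    also have "\<dots> \<le> (\<Sum>k=1..n. \<Sum>l=1..n. D \<bullet> D - 2 * (D \<bullet> S y) + 2 * (D \<bullet> u k l))"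
      by (intro sum_mono est)
    also have "\<dots> = (real n)\<^sup>2 * (D \<bullet> D - 2 * (D \<bullet> S y)) + 2 * (D \<bullet> (\<Sum>k=1..n. \<Sum>l=1..n. u k l))"
      by (simp add: sum.distrib sum_subtractf inner_sum_right sum_distrib_left power2_eq_square algebra_simps)
    also have "\<dots> = (real n)\<^sup>2 * (D \<bullet> D - 2 * (D \<bullet> S y) + 2 * (D \<bullet> square_average u n))"
      using that by (simp add: square_average_def field_simps)
    finally have "real n * - M
        \<le> real n * (real n * (D \<bullet> D - 2 * (D \<bullet> S y) + 2 * (D \<bullet> square_average u n)))"
      by (simp add: power2_eq_square mult.assoc)
    then have "- M \<le> real n * (D \<bullet> D - 2 * (D \<bullet> S y) + 2 * (D \<bullet> square_average u n))"
      using that by (subst (asm) mult_le_cancel_left_pos) auto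
    then show ?thesis using that by (simp add: field_simps)
  qed
  have "((\<lambda>n. - (M * (1 / real n))) \<longlongrightarrow> - (M * 0)) G"
    by (intro tendsto_intros tendsto_mono[OF G(1) lim_1_over_n])
  moreover have "((\<lambda>n. D \<bullet> D - 2 * (D \<bullet> S y) + 2 * (D \<bullet> square_average u n))
      \<longlongrightarrow> D \<bullet> D - 2 * (D \<bullet> S y) + 2 * (D \<bullet> y)) G"
    by (intro tendsto_intros lim)
  moreover have "eventually (\<lambda>n. - (M * (1 / real n))
      \<le> D \<bullet> D - 2 * (D \<bullet> S y) + 2 * (D \<bullet> square_average u n)) G"
    using filter_leD[OF G(1) eventually_gt_at_top[of 0]] by eventually_elim (rule bound)
  ultimately have "- (M * 0) \<le> D \<bullet> D - 2 * (D \<bullet> S y) + 2 * (D \<bullet> y)"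
    using tendsto_le[OF G(2)] by blast
  \<comment> \<open>Here \<open>D \<bullet> S y - D \<bullet> y = D \<bullet> D\<close>, so the
    linear terms contribute \<open>- 2 * (D \<bullet> D)\<close>.\<close>
  also have "\<dots> = - (D \<bullet> D)"
    by (simp add: D_def inner_diff_right)
  finally have "D \<bullet> D \<le> 0" by simp
  then have "D = 0" by (metis inner_gt_zero_iff leD)
  then show ?thesis by (simp add: D_def)
qed

text \<open>By polarisation, \<open>u k l \<bullet> (f - g)\<close> is a constant plus half the difference of the squared
  distances from \<open>u k l\<close> to \<open>g\<close> and to \<open>f\<close>, both of which decrease along the orbit.\<close>

lemma square_average_inner_convergent:
  fixes u :: "nat \<Rightarrow> nat \<Rightarrow> 'a::real_inner"
  assumes "\<And>k l h. h \<in> {f, g} \<Longrightarrow> norm (u (Suc k) l - h) \<le> norm (u k l - h)"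
    and "\<And>k l h. h \<in> {f, g} \<Longrightarrow> norm (u k (Suc l) - h) \<le> norm (u k l - h)"
  shows "convergent (\<lambda>n. (f - g) \<bullet> square_average u n)"
proof -
  define A where "A = (\<lambda>h n. (\<Sum>k=1..n. \<Sum>l=1..n. (norm (u k l - h))\<^sup>2) / (real n)\<^sup>2)"
  have "convergent (A h)" if "h \<in> {f, g}" for h
    unfolding A_def using assms(1,2)[OF that]
    by (intro convergent_square_average) (auto intro: power_mono)
  then have "convergent (A f)" "convergent (A g)" by auto
  then obtain Lf Lg where "A f \<longlonglongrightarrow> Lf" "A g \<longlonglongrightarrow> Lg" by (auto simp: convergent_def)
  then have "(\<lambda>n. (f \<bullet> f - g \<bullet> g + A g n - A f n) / 2) \<longlonglongrightarrow> (f \<bullet> f - g \<bullet> g + Lg - Lf) / 2"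
    by (intro tendsto_intros) auto
  \<comment> \<open>At \<open>n = 0\<close> all averages vanish while the constant may not, so the
    identity is only eventual.\<close>
  moreover have "(f \<bullet> f - g \<bullet> g + A g n - A f n) / 2 = (f - g) \<bullet> square_average u n" if "n > 0" for n
  proof -
    have polar: "(f - g) \<bullet> u k l = (f \<bullet> f - g \<bullet> g + (norm (u k l - g))\<^sup>2 - (norm (u k l - f))\<^sup>2) / 2" for k l
      by (simp add: power2_norm_eq_inner inner_simps inner_commute)
    have "(f - g) \<bullet> square_average u n = (\<Sum>k=1..n. \<Sum>l=1..n.
        (f \<bullet> f - g \<bullet> g + (norm (u k l - g))\<^sup>2 - (norm (u k l - f))\<^sup>2) / 2) / (real n)\<^sup>2"
      unfolding square_average_def inner_scaleR_right inner_sum_right polar by simp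
    also have "\<dots> = (f \<bullet> f - g \<bullet> g + A g n - A f n) / 2"
      using that by (simp add: A_def sum.distrib sum_subtractf field_simps power2_eq_square
          flip: sum_divide_distrib)
    finally show ?thesis by simp
  qed
  then have "eventually (\<lambda>n. (f \<bullet> f - g \<bullet> g + A g n - A f n) / 2 = (f - g) \<bullet> square_average u n) sequentially"
    by (intro eventually_mono[OF eventually_gt_at_top[of 0]])
  ultimately show ?thesis
    by (intro convergentI) (rule Lim_transform_eventually)
qed

section \<open>Times fixing a point\<close>

text \<open>Let \<open>d\<close> be the infimum of the positive elements. If \<open>d > 0\<close>,
  then \<open>d \<in> A\<close> by closedness, and division with remainder makes every element a
  multiple of \<open>d\<close>, so \<open>\<alpha> / \<beta>\<close> would be rational. If
  \<open>d = 0\<close>, multiples of arbitrarily small elements of \<open>A\<close> are dense in the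
  half-line.\<close>

lemma closed_subtractive_set_eq_halfline:
  fixes A :: "real set"
  assumes "closed A" "A \<subseteq> {0..}"
    and add: "\<And>s t. s \<in> A \<Longrightarrow> t \<in> A \<Longrightarrow> s + t \<in> A"
    and diff: "\<And>s t. s \<in> A \<Longrightarrow> t \<in> A \<Longrightarrow> s \<le> t \<Longrightarrow> t - s \<in> A"
    and "\<alpha> \<in> A" "\<beta> \<in> A" "\<alpha> > 0" "\<beta> > 0" "\<alpha> / \<beta> \<notin> \<rat>"
  shows "A = {0..}"
proof -
  have zero: "0 \<in> A" using diff[OF \<open>\<alpha> \<in> A\<close> \<open>\<alpha> \<in> A\<close>] by simp
  have mult: "real n * s \<in> A" if "s \<in> A" for n s
    by (induction n) (auto simp: zero add that algebra_simps)
  have floor_mult: "real_of_int \<lfloor>t / s\<rfloor> * s \<in> A" "real_of_int \<lfloor>t / s\<rfloor> * s \<le> t" "t < real_of_int \<lfloor>t / s\<rfloor> * s + s"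
    if "s \<in> A" "s > 0" "t \<ge> 0" for s t
  proof -
    have "real_of_int \<lfloor>t / s\<rfloor> = real (nat \<lfloor>t / s\<rfloor>)"
      using that by simp
    then show "real_of_int \<lfloor>t / s\<rfloor> * s \<in> A" using mult[OF \<open>s \<in> A\<close>] by metis
    show "real_of_int \<lfloor>t / s\<rfloor> * s \<le> t"
      using that by (intro floor_divide_lower)
    show "t < real_of_int \<lfloor>t / s\<rfloor> * s + s"
      using floor_divide_upper[OF \<open>s > 0\<close>, of t] by (simp add: algebra_simps)
  qed
  define P where "P = A \<inter> {0<..}"
  have "\<alpha> \<in> P" using assms by (simp add: P_def)
  then have P: "P \<noteq> {}" "bdd_below P" by (auto simp: P_def intro: bdd_belowI[of _ 0])
  define d where "d = Inf P"
  have "d \<ge> 0" unfolding d_def by (rule cInf_greatest[OF P(1)]) (auto simp: P_def)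
  have "d \<in> A"
  proof -
    have "d \<in> closure P" unfolding d_def by (rule closure_contains_Inf[OF P])
    then show ?thesis using closure_mono[of P A] \<open>closed A\<close> by (auto simp: P_def)
  qed
  have "d = 0"
  proof (rule ccontr)
    assume "d \<noteq> 0"
    then have "d > 0" using \<open>d \<ge> 0\<close> by simp
    have "t / d \<in> \<rat>" if "t \<in> A" for t
    proof -
      have "t \<ge> 0" using that assms(2) by auto
      note fl = floor_mult[OF \<open>d \<in> A\<close> \<open>d > 0\<close> this]
      have "t - real_of_int \<lfloor>t / d\<rfloor> * d \<in> A" using diff fl that by blast
      moreover have "d \<le> s" if "s \<in> P" for s unfolding d_def using that P(2) by (rule cInf_lower)
      \<comment> \<open>The remainder lies in \<open>A\<close> and in \<open>[0, d)\<close>, where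
        the only possible element of \<open>A\<close> is 0.\<close>
      ultimately have "t - real_of_int \<lfloor>t / d\<rfloor> * d = 0"
        using fl by (force simp: P_def)
      then have "t / d = real_of_int \<lfloor>t / d\<rfloor>" using \<open>d > 0\<close> by (simp add: field_simps)
      then show ?thesis by (metis Rats_of_int)
    qed
    then have "(\<alpha> / d) / (\<beta> / d) \<in> \<rat>" using assms by (blast intro: Rats_divide)
    then show False using \<open>d > 0\<close> assms by simp
  qed
  have "t \<in> A" if "t \<ge> 0" for t
  proof -
    have "\<exists>s\<in>A. dist s t < e" if "e > 0" for e
    proof -
      obtain s where "s \<in> P" "s < e"
        using cInf_less_iff[OF P, of e] \<open>d = 0\<close> \<open>e > 0\<close> by (auto simp: d_def)
      then have "s \<in> A" "s > 0" by (auto simp: P_def)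
      note fl = floor_mult[OF this \<open>t \<ge> 0\<close>]
      then show ?thesis using \<open>s < e\<close>
        by (intro bexI[of _ "real_of_int \<lfloor>t / s\<rfloor> * s"]) (auto simp: dist_real_def)
    qed
    then have "t \<in> closure A" by (simp add: closure_approachable)
    then show ?thesis using \<open>closed A\<close> by simp
  qed
  then show ?thesis using assms(2) by auto
qed

text \<open>The fixing times are the preimage of the \<open>\<tau>\<close>-closed set
  \<open>{z}\<close>, and \<open>T t z = T (t - s) (T s z)\<close> makes them stable under
  differences. In particular time 0 is obtained as \<open>\<alpha> - \<alpha>\<close>, although
  \<open>T 0\<close> need not be the identity.\<close>

lemma semigroup_fixed_imp_common_fixed:
  assumes sg: "nonexpansive_semigroup \<tau> C T" and "topspace \<tau> = UNIV" "Hausdorff_space \<tau>"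
    and "\<alpha> > 0" "\<beta> > 0" "\<alpha> / \<beta> \<notin> \<rat>"
    and "z \<in> C" "T \<alpha> z = z" "T \<beta> z = z"
  shows "common_fixed_point C T z"
proof -
  have sg1: "T (s + t) z = T s (T t z)" if "s \<ge> 0" "t \<ge> 0" for s t
    using sg that \<open>z \<in> C\<close> by (simp add: nonexpansive_semigroup_def)
  have cont: "continuous_map (top_of_set {0..}) \<tau> (\<lambda>t. T t z)"
    using sg \<open>z \<in> C\<close> by (simp add: nonexpansive_semigroup_def continuous_map_in_subtopology)
  define A where "A = {t. t \<ge> 0 \<and> T t z = z}"
  have closed_z: "closedin \<tau> {z}"
    using assms by (intro closedin_Hausdorff_singleton) auto
  have "closedin (top_of_set {0..}) {t \<in> {0..}. T t z \<in> {z}}"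
    using closedin_continuous_map_preimage[OF cont closed_z] by simp
  then have "closedin (top_of_set {0..}) A" by (simp add: A_def)
  then have "closed A" by (rule closedin_closed_trans) simp
  then have "A = {0..}"
  proof (rule closed_subtractive_set_eq_halfline)
    show "s + t \<in> A" if "s \<in> A" "t \<in> A" for s t
      using that sg1[of s t] by (simp add: A_def)
    show "t - s \<in> A" if "s \<in> A" "t \<in> A" "s \<le> t" for s t
      using that sg1[of "t - s" s] by (simp add: A_def)
  qed (use assms in \<open>auto simp: A_def\<close>)
  then show ?thesis using \<open>z \<in> C\<close> by (auto simp: common_fixed_point_def A_def)
qed

section \<open>Weak convergence of the orbit averages\<close>

theorem theorem5:
  fixes \<tau> :: "'a::{real_inner, banach} topology"
    and C :: "'a set"
    and T :: "real \<Rightarrow> 'a \<Rightarrow> 'a"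
    and \<alpha> \<beta> :: real
    and x :: 'a
    and xs :: "nat \<Rightarrow> 'a"
  assumes "topspace \<tau> = UNIV" and "Hausdorff_space \<tau>"
    and "bounded C" and "closed C" and "convex C"
    and "nonexpansive_semigroup \<tau> C T"
    and "\<alpha> > 0" and "\<beta> > 0" and "\<alpha> / \<beta> \<notin> \<rat>"
    and "x \<in> C"
    and "\<And>n. n \<ge> 1 \<Longrightarrow>
      xs n = (1 / (real n)\<^sup>2) *\<^sub>R
        (\<Sum>k=1..n. \<Sum>l=1..n. T (real k * \<alpha> + real l * \<beta>) x)"
  shows "\<exists>z. common_fixed_point C T z \<and> weakly_converges_to xs z"
proof -
  define u where "u = (\<lambda>k l. T (real k * \<alpha> + real l * \<beta>) x)"
  let ?X = "square_average u"
  have maps: "T t \<in> C \<rightarrow> C" if "t \<ge> 0" for t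
    using assms that by (simp add: nonexpansive_semigroup_def)
  have sg1: "T (s + t) x = T s (T t x)" if "s \<ge> 0" "t \<ge> 0" for s t
    using assms that by (simp add: nonexpansive_semigroup_def)
  have nonexp: "norm (T t v - T t w) \<le> norm (v - w)" if "t \<ge> 0" "v \<in> C" "w \<in> C" for t v w
    using assms that by (simp add: nonexpansive_semigroup_def)
  have pos: "real k * \<alpha> + real l * \<beta> \<ge> 0" for k l using assms by simp
  have uC: "u k l \<in> C" for k l
    unfolding u_def using maps[OF pos] \<open>x \<in> C\<close> by blast
  have u1: "u (Suc k) l = T \<alpha> (u k l)" for k l
    using sg1[OF _ pos, of \<alpha> k l] \<open>\<alpha> > 0\<close> by (simp add: u_def algebra_simps)
  have u2: "u k (Suc l) = T \<beta> (u k l)" for k l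
    using sg1[OF _ pos, of \<beta> k l] \<open>\<beta> > 0\<close> by (simp add: u_def algebra_simps)
  have XC: "eventually (\<lambda>n. ?X n \<in> C) sequentially"
    using eventually_gt_at_top[of 0]
    by eventually_elim (intro square_average_in_convex \<open>convex C\<close> uC)
  obtain B where B: "\<And>v. v \<in> C \<Longrightarrow> norm v \<le> B"
    using \<open>bounded C\<close> by (auto simp: bounded_iff)
  have bdd: "eventually (\<lambda>n. norm (?X n) \<le> B) sequentially"
    using XC by eventually_elim (rule B)
  have cluster: "common_fixed_point C T y"
    if G: "G \<le> sequentially" "G \<noteq> bot" and lim: "\<And>w. ((\<lambda>n. w \<bullet> ?X n) \<longlongrightarrow> w \<bullet> y) G" for G y
  proof -
    \<comment> \<open>Swapping the indices leaves the averages unchanged and turns the shift by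
      \<open>T \<beta>\<close> into a shift of the first index.\<close>
    have lim': "((\<lambda>n. w \<bullet> square_average (\<lambda>k l. u l k) n) \<longlongrightarrow> w \<bullet> y) G" for w
      unfolding square_average_swap[of u] by (rule lim)
    have "y \<in> C"
      using weak_limit_in_closed_convex[OF \<open>convex C\<close> \<open>closed C\<close> G(2) filter_leD[OF G(1) XC] lim] .
    moreover have "T \<alpha> y = y"
      using \<open>\<alpha> > 0\<close>
      by (intro square_average_cluster_fixed[OF \<open>bounded C\<close> maps nonexp uC u1 G lim \<open>y \<in> C\<close>]) auto
    moreover have "T \<beta> y = y"
      using \<open>\<beta> > 0\<close>
      by (intro square_average_cluster_fixed[where u = "\<lambda>k l. u l k", OF \<open>bounded C\<close> maps nonexp uC u2 G lim' \<open>y \<in> C\<close>]) auto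
    ultimately show ?thesis
      using assms by (intro semigroup_fixed_imp_common_fixed[of \<tau> C T \<alpha> \<beta>])
  qed
  obtain G z where G: "G \<le> sequentially" "G \<noteq> bot" and z: "\<And>w. ((\<lambda>n. w \<bullet> ?X n) \<longlongrightarrow> w \<bullet> z) G"
    using bounded_weak_cluster_point[OF sequentially_bot bdd] by blast
  \<comment> \<open>The full sequence \<open>(y - z) \<bullet> ?X n\<close> converges, so its limits
    \<open>(y - z) \<bullet> y\<close> along \<open>G'\<close> and
    \<open>(y - z) \<bullet> z\<close> along \<open>G\<close> agree.\<close>
  have unique: "y = z"
    if G': "G' \<le> sequentially" "G' \<noteq> bot" and y: "\<And>w. ((\<lambda>n. w \<bullet> ?X n) \<longlongrightarrow> w \<bullet> y) G'" for G' y
  proof -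
    have fp: "h \<in> C" "T \<alpha> h = h" "T \<beta> h = h" if "h \<in> {y, z}" for h
      using cluster[OF G z] cluster[OF G' y] that assms by (auto simp: common_fixed_point_def)
    have "convergent (\<lambda>n. (y - z) \<bullet> ?X n)"
    proof (rule square_average_inner_convergent)
      show "norm (u (Suc k) l - h) \<le> norm (u k l - h)" if "h \<in> {y, z}" for k l h
        using nonexp[OF _ uC fp(1)[OF that], of \<alpha> k l] fp[OF that] \<open>\<alpha> > 0\<close> by (simp add: u1)
      show "norm (u k (Suc l) - h) \<le> norm (u k l - h)" if "h \<in> {y, z}" for k l h
        using nonexp[OF _ uC fp(1)[OF that], of \<beta> k l] fp[OF that] \<open>\<beta> > 0\<close> by (simp add: u2)
    qed
    then obtain L where L: "(\<lambda>n. (y - z) \<bullet> ?X n) \<longlonglongrightarrow> L" by (auto simp: convergent_def)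
    have "(y - z) \<bullet> y = L"
      using tendsto_unique[OF G'(2) y tendsto_mono[OF G'(1) L]] .
    moreover have "(y - z) \<bullet> z = L"
      using tendsto_unique[OF G(2) z tendsto_mono[OF G(1) L]] .
    ultimately have "(y - z) \<bullet> (y - z) = 0" by (simp add: inner_diff_right)
    then show "y = z" by simp
  qed
  have weak: "(\<lambda>n. w \<bullet> ?X n) \<longlonglongrightarrow> w \<bullet> z" for w
  proof (rule ccontr)
    assume "\<not> ?thesis"
    then obtain e where e: "e > 0" "\<not> eventually (\<lambda>n. dist (w \<bullet> ?X n) (w \<bullet> z) < e) sequentially"
      by (auto simp: tendsto_iff)
    \<comment> \<open>\<open>F\<close> restricts to the indices where convergence fails by at least
      \<open>e\<close>; a weak cluster point along \<open>F\<close> would have to be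
      \<open>z\<close>, which is impossible.\<close>
    define F where "F = inf sequentially (principal {n. \<not> dist (w \<bullet> ?X n) (w \<bullet> z) < e})"
    have "F \<noteq> bot"
      using e(2) by (simp add: F_def trivial_limit_def eventually_inf_principal)
    moreover have F_le: "F \<le> sequentially" by (simp add: F_def)
    ultimately obtain G' y where G': "G' \<le> F" "G' \<noteq> bot" and y: "\<And>w. ((\<lambda>n. w \<bullet> ?X n) \<longlongrightarrow> w \<bullet> y) G'"
      using bounded_weak_cluster_point[OF _ filter_leD[OF _ bdd]] by blast
    have "y = z" using unique[OF order_trans[OF G'(1) F_le] G'(2) y] .
    then have "eventually (\<lambda>n. dist (w \<bullet> ?X n) (w \<bullet> z) < e) G'"
      using y e(1) by (simp add: tendsto_iff)
    moreover have "eventually (\<lambda>n. \<not> dist (w \<bullet> ?X n) (w \<bullet> z) < e) G'"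
      by (rule filter_leD[OF G'(1)]) (simp add: F_def eventually_inf_principal)
    ultimately have "eventually (\<lambda>_. False) G'" by eventually_elim simp
    then show False using G'(2) by simp
  qed
  have "weakly_converges_to xs z"
    unfolding weakly_converges_to_def
  proof (intro allI impI)
    fix f :: "'a \<Rightarrow> real" assume "bounded_linear f"
    then obtain p where p: "\<And>w. f w = w \<bullet> p" using riesz_representation by blast
    \<comment> \<open>Only eventual equality holds in general, as \<open>xs 0\<close> is
      arbitrary.\<close>
    have "eventually (\<lambda>n. p \<bullet> ?X n = f (xs n)) sequentially"
      using eventually_ge_at_top[of 1]
      by eventually_elim (simp add: assms(11) p square_average_def u_def inner_commute)
    with weak[of p] show "(\<lambda>n. f (xs n)) \<longlonglongrightarrow> f z"
      by (simp add: p inner_commute[of _ p] Lim_transform_eventually)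
  qed
  then show ?thesis using cluster[OF G z] by blast
qed

end
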